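(* Let $n\ge 1$. Let $\Phi_n$ be the poset whose vertex set is $\{0,1\}^n$, whose partial order is the one generated by the covering relation: $y$ covers $x$ if and only if $y-x$ (coordinatewise difference) is an alternating sequence. Then the alternating sign matrices of order $n$ are in bijection with the maximal chains of $\Phi_n$. Explicitly: given a maximal chain $x_0<x_1<\cdots<x_n$ in $\Phi_n$, the corresponding alternating sign matrix has row $i$ equal to $x_i-x_{i-1}$ for $1\le i\le n$; conversely, given an alternating sign matrix of order $n$, letting $x_i$ be the sum of its rows $1,2,\ldots,i$ $(0\le i\le n)$, the sequence $x_0<x_1<\cdots<x_n$ is the corresponding maximal chain of $\Phi_n$.
   Context: A sequence $(\alpha_1,\ldots,\alpha_n)$ is alternating if each $\alpha_i\in\{1,0,-1\}$ and its nonzero entries, read left to right, form the pattern $1,-1,1,-1,\ldots,-1,1$. An alternating sign matrix of order $n$ is an $n\times n$ matrix each of whose rows and columns is alternating. The rank of a vertex of $\Phi_n$ is its number of nonzero coordinates; if $y$ covers $x$ then the rank of $y$ is one more than that of $x$. A chain $x_0<\cdots<x_r$ is maximal if $x_r$ is a maximal element, $x_0$ is a minimal element, and $x_i$ covers $x_{i-1}$ for $1\le i\le r$. ($\Phi_n$ has unique minimum $(0,\ldots,0)$ and unique maximum $(1,\ldots,1)$, and its maximal chains are exactly the chains of length $n$.) *)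

theory Defs
  imports "Jordan_Normal_Form.Matrix"
begin

definition alternating :: "int list \<Rightarrow> bool" where
  "alternating as \<longleftrightarrow> set as \<subseteq> {1, 0, -1} \<and>
     (\<exists>k. filter (\<lambda>a. a \<noteq> 0) as = map (\<lambda>i. (-1) ^ i) [0..<2 * k + 1])"

definition asms :: "nat \<Rightarrow> int mat set" where
  "asms n = {A \<in> carrier_mat n n.
     (\<forall>i<n. alternating (list_of_vec (row A i))) \<and>
     (\<forall>j<n. alternating (list_of_vec (col A j)))}"

text \<open>Order relations are sets of pairs \<open>(x, y)\<close> meaning \<open>x \<le> y\<close>, on a carrier set \<open>V\<close>.\<close>

definition covers_in :: "'a set \<Rightarrow> 'a rel \<Rightarrow> 'a \<Rightarrow> 'a \<Rightarrow> bool" where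
  "covers_in V r y x \<longleftrightarrow> x \<in> V \<and> y \<in> V \<and> (x, y) \<in> r \<and> x \<noteq> y \<and>
     \<not> (\<exists>z\<in>V. (x, z) \<in> r \<and> x \<noteq> z \<and> (z, y) \<in> r \<and> z \<noteq> y)"

definition minimal_in :: "'a set \<Rightarrow> 'a rel \<Rightarrow> 'a \<Rightarrow> bool" where
  "minimal_in V r x \<longleftrightarrow> x \<in> V \<and> (\<forall>y\<in>V. (y, x) \<in> r \<longrightarrow> y = x)"

definition maximal_in :: "'a set \<Rightarrow> 'a rel \<Rightarrow> 'a \<Rightarrow> bool" where
  "maximal_in V r x \<longleftrightarrow> x \<in> V \<and> (\<forall>y\<in>V. (x, y) \<in> r \<longrightarrow> y = x)"

text \<open>The list \<open>[x\<^sub>0, \<dots>, x\<^sub>r]\<close> represents the chain \<open>x\<^sub>0 < \<dots> < x\<^sub>r\<close>; its length is not prescribed.\<close>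

definition maximal_chains :: "'a set \<Rightarrow> 'a rel \<Rightarrow> 'a list set" where
  "maximal_chains V r = {xs. xs \<noteq> [] \<and> minimal_in V r (hd xs) \<and> maximal_in V r (last xs) \<and>
     (\<forall>i. 1 \<le> i \<and> i < length xs \<longrightarrow> covers_in V r (xs ! i) (xs ! (i - 1)))}"

definition Phi_verts :: "nat \<Rightarrow> int vec set" where
  "Phi_verts n = {x \<in> carrier_vec n. \<forall>i<n. x $ i \<in> {0, 1}}"

definition Phi_gen :: "nat \<Rightarrow> int vec rel" where
  "Phi_gen n = {(x, y). x \<in> Phi_verts n \<and> y \<in> Phi_verts n \<and> alternating (list_of_vec (y - x))}"

definition Phi_order :: "nat \<Rightarrow> int vec rel" where
  "Phi_order n = (Phi_gen n)\<^sup>* \<inter> (Phi_verts n \<times> Phi_verts n)"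

abbreviation Phi_maximal_chains :: "nat \<Rightarrow> int vec list set" where
  "Phi_maximal_chains n \<equiv> maximal_chains (Phi_verts n) (Phi_order n)"

text \<open>Rows of matrices are indexed from 0, so row \<open>i\<close> of the mathematical text is \<open>row A (i - 1)\<close>.
  The number of rows below is the length of the chain, so membership of the result in
  \<open>asms n\<close> includes the fact that the chain has length \<open>n\<close>.\<close>

definition chain_to_asm :: "nat \<Rightarrow> int vec list \<Rightarrow> int mat" where
  "chain_to_asm n xs = mat_of_rows n (map (\<lambda>i. xs ! i - xs ! (i - 1)) [1..<length xs])"

definition asm_to_chain :: "nat \<Rightarrow> int mat \<Rightarrow> int vec list" where
  "asm_to_chain n A = map (\<lambda>i. vec n (\<lambda>j. \<Sum>k<i. row A k $ j)) [0..<n + 1]"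

end

theory Submission imports Defs begin

text \<open>A sequence is alternating iff all its partial sums lie in \<open>{0, 1}\<close> and its total is 1.
  Hence a covering step raises the rank by exactly one, so the generating relation consists
  precisely of the covers. The column condition on an alternating sign matrix says that the partial
  sums of its rows are 0/1 vectors running from the zero vector to the all-one vector; the row
  condition says that consecutive partial sums are related by a covering step.\<close>

section \<open>Alternating sequences and partial sums\<close>

text \<open>The bit \<open>s\<close> is the sum of the entries already read.\<close>

fun alternating_from :: "int \<Rightarrow> int list \<Rightarrow> bool" where
  "alternating_from s [] \<longleftrightarrow> s = 1"
| "alternating_from s (a # as) \<longleftrightarrow> s + a \<in> {0, 1} \<and> alternating_from (s + a) as"

text \<open>The recursion tests the running sum after each entry, which is exactly a test of every
  nonempty prefix; the empty prefix is covered by the hypothesis on \<open>s\<close>.\<close>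

lemma alternating_from_iff_partial_sums:
  assumes "s \<in> {0, 1}"
  shows "alternating_from s as \<longleftrightarrow>
    (\<forall>m\<le>length as. s + sum_list (take m as) \<in> {0, 1}) \<and> s + sum_list as = 1"
  using assms
proof (induction as arbitrary: s)
  case Nil
  then show ?case by auto
next
  case (Cons a as)
  \<comment> \<open>Absorbing \<open>a\<close> into the start value shifts prefix lengths by one;
    the lost length 0 only asks for \<open>s \<in> {0, 1}\<close>.\<close>
  have split: "(\<forall>m\<le>length (a # as). s + sum_list (take m (a # as)) \<in> {0, 1}) \<longleftrightarrow>
      (\<forall>m\<le>length as. s + a + sum_list (take m as) \<in> {0, 1})" (is "?L \<longleftrightarrow> ?R")
  proof
    assume L: ?L
    show ?R
    proof (intro allI impI)
      fix m assume "m \<le> length as"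
      then show "s + a + sum_list (take m as) \<in> {0, 1}"
        using L[rule_format, of "Suc m"] by (simp add: add.assoc)
    qed
  next
    assume R: ?R
    show ?L
    proof (intro allI impI)
      fix m assume "m \<le> length (a # as)"
      then show "s + sum_list (take m (a # as)) \<in> {0, 1}"
        using R[rule_format, of "m - 1"] Cons.prems by (cases m) (auto simp: add.assoc)
    qed
  qed
  show ?case
  proof (cases "s + a \<in> {0, 1}")
    case True
    then show ?thesis unfolding split using Cons.IH[OF True] by (simp add: add.assoc)
  next
    case False
    \<comment> \<open>The empty prefix, \<open>m = 0\<close>, is already a counterexample.\<close>
    then have "\<not> (\<forall>m\<le>length as. s + a + sum_list (take m as) \<in> {0, 1})"
      by (metis add_0_right sum_list.Nil take0 zero_le)
    with False show ?thesis unfolding split by simp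
  qed
qed

text \<open>Starting the sign pattern at index \<open>s\<close> removes its leading 1 when \<open>s = 1\<close>.\<close>

lemma alternating_from_iff_filter:
  assumes "s \<le> 1"
  shows "alternating_from (int s) as \<longleftrightarrow> set as \<subseteq> {1, 0, -1} \<and>
     (\<exists>k. filter (\<lambda>a. a \<noteq> 0) as = map (\<lambda>i. (-1) ^ i) [s..<2 * k + 1])"
  using assms
proof (induction as arbitrary: s)
  case Nil
  then consider "s = 0" | "s = 1" by linarith
  then show ?case
    \<comment> \<open>With \<open>s = 1\<close>, \<open>k = 0\<close> gives the empty range
      \<open>[1..<1]\<close>; with \<open>s = 0\<close> the pattern is never empty.\<close>
    by cases (auto intro: exI[of _ 0])
next
  case (Cons a as)
  have pattern0: "map (\<lambda>i. (-1) ^ i) [0..<2 * k + 1] =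
      (1::int) # map (\<lambda>i. (-1) ^ i) [1..<2 * k + 1]" for k
    by (subst upt_conv_Cons) auto
  \<comment> \<open>The signs depend only on the parity of the index, so from index 2 on the pattern
    repeats the one from index 0.\<close>
  have pattern1: "map (\<lambda>i. (-1) ^ i) [1..<2 * Suc k + 1] =
      (-1::int) # map (\<lambda>i. (-1) ^ i) [0..<2 * k + 1]" for k
  proof -
    have "[1..<2 * Suc k + 1] = 1 # [2..<2 * k + 1 + 2]"
      by (subst upt_conv_Cons) (auto simp: numeral_2_eq_2)
    moreover have "[2..<2 * k + 1 + 2] = map (\<lambda>i. i + 2) [0..<2 * k + 1]"
      by (subst map_add_upt) simp
    ultimately show ?thesis by (simp add: o_def del: upt_Suc)
  qed
  \<comment> \<open>At running sum 1 the nonzero entries may end, or must return to sum 0 and begin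
    afresh.\<close>
  have pattern1': "(\<exists>k. xs = map (\<lambda>i. (-1::int) ^ i) [1..<2 * k + 1]) \<longleftrightarrow>
      xs = [] \<or> (\<exists>k. xs = -1 # map (\<lambda>i. (-1) ^ i) [0..<2 * k + 1])" for xs
  proof
    assume "\<exists>k. xs = map (\<lambda>i. (-1::int) ^ i) [1..<2 * k + 1]"
    then obtain k where k: "xs = map (\<lambda>i. (-1::int) ^ i) [1..<2 * k + 1]" ..
    show "xs = [] \<or> (\<exists>k. xs = -1 # map (\<lambda>i. (-1) ^ i) [0..<2 * k + 1])"
    proof (cases k)
      case 0
      then show ?thesis using k by simp
    next
      case (Suc l)
      then show ?thesis using k pattern1[of l] by metis
    qed
  next
    assume "xs = [] \<or> (\<exists>k. xs = -1 # map (\<lambda>i. (-1) ^ i) [0..<2 * k + 1])"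
    then show "\<exists>k. xs = map (\<lambda>i. (-1::int) ^ i) [1..<2 * k + 1]"
    proof
      assume "xs = []"
      then show ?thesis by (intro exI[of _ 0]) simp
    next
      assume "\<exists>k. xs = -1 # map (\<lambda>i. (-1) ^ i) [0..<2 * k + 1]"
      then show ?thesis using pattern1 by metis
    qed
  qed
  have IH0: "alternating_from 0 as \<longleftrightarrow> set as \<subseteq> {1, 0, -1} \<and>
      (\<exists>k. filter (\<lambda>a. a \<noteq> 0) as = map (\<lambda>i. (-1) ^ i) [0..<2 * k + 1])"
    using Cons.IH[of 0] by (simp del: upt_Suc)
  have IH1: "alternating_from 1 as \<longleftrightarrow> set as \<subseteq> {1, 0, -1} \<and>
      (\<exists>k. filter (\<lambda>a. a \<noteq> 0) as = map (\<lambda>i. (-1) ^ i) [1..<2 * k + 1])"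
    using Cons.IH[of 1] by (simp del: upt_Suc)
  consider "a = 0" | "a = 1" | "a = -1" | "a \<notin> {1, 0, -1}" by auto
  moreover from Cons.prems consider "s = 0" | "s = 1" by linarith
  ultimately consider "a = 0" "s = 0" | "a = 0" "s = 1" | "a = 1" "s = 0" | "a = 1" "s = 1"
    | "a = -1" "s = 0" | "a = -1" "s = 1" | "a \<notin> {1, 0, -1}" by metis
  then show ?case
  proof cases
    case 1
    then show ?thesis using IH0 by (simp del: upt_Suc)
  next
    case 2
    then show ?thesis using IH1 by (simp del: upt_Suc)
  next
    case 3
    show ?thesis unfolding 3 pattern0 using IH1 by (simp del: upt_Suc)
  next
    \<comment> \<open>Here the sum would become 2, and in the next case -1; the pattern demands the
      opposite sign at both places.\<close>
    case 4
    then show ?thesis using pattern1'[of "1 # filter (\<lambda>a. a \<noteq> 0) as"] by (simp del: upt_Suc)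
  next
    case 5
    show ?thesis unfolding 5 pattern0 by (simp del: upt_Suc)
  next
    case 6
    then show ?thesis using IH0 pattern1'[of "-1 # filter (\<lambda>a. a \<noteq> 0) as"]
      by (simp del: upt_Suc)
  next
    case 7
    then have "int s + a \<notin> {0, 1}" using Cons.prems by auto
    with 7 show ?thesis by simp
  qed
qed

text \<open>Combines the two descriptions of \<open>alternating_from\<close> at
  \<open>s = 0\<close>, so that later arguments work with sums instead of sign patterns.\<close>

lemma alternating_iff_partial_sums:
  "alternating as \<longleftrightarrow> (\<forall>m\<le>length as. sum_list (take m as) \<in> {0, 1}) \<and> sum_list as = 1"
  using alternating_from_iff_filter[of 0 as] alternating_from_iff_partial_sums[of 0 as]
  unfolding alternating_def by simp

section \<open>Coordinate sums of vectors\<close>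

lemma sum_list_take_list_of_vec:
  assumes "m \<le> dim_vec v"
  shows "sum_list (take m (list_of_vec v)) = (\<Sum>j<m. v $ j)"
proof -
  have "list_of_vec v = map (($) v) [0..<dim_vec v]"
    by (rule nth_equalityI) (auto simp: list_of_vec_index)
  then have "take m (list_of_vec v) = map (($) v) [0..<m]"
    using assms by (simp add: take_map)
  then show ?thesis
    by (simp add: interv_sum_list_conv_sum_set_nat atLeast0LessThan)
qed

lemma alternating_vec_iff:
  assumes "v \<in> carrier_vec n"
  shows "alternating (list_of_vec v) \<longleftrightarrow>
    (\<forall>m\<le>n. (\<Sum>j<m. v $ j) \<in> {0, 1}) \<and> (\<Sum>j<n. v $ j) = 1"
proof -
  have n: "dim_vec v = n" using assms by simp
  have "sum_list (list_of_vec v) = (\<Sum>j<n. v $ j)"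
    using sum_list_take_list_of_vec[of n v] n by simp
  moreover have "sum_list (take m (list_of_vec v)) = (\<Sum>j<m. v $ j)" if "m \<le> n" for m
    using sum_list_take_list_of_vec[of m v] n that by simp
  ultimately show ?thesis
    unfolding alternating_iff_partial_sums by (simp add: n)
qed

section \<open>The order and its covers\<close>

text \<open>On 0/1 vectors this counts the nonzero coordinates. As a sum it is additive, so the rank
  gained in a step is the total of the difference vector.\<close>

definition rank :: "int vec \<Rightarrow> int" where
  "rank x = (\<Sum>j<dim_vec x. x $ j)"

lemma Phi_verts_carrier: "x \<in> Phi_verts n \<Longrightarrow> x \<in> carrier_vec n"
  by (simp add: Phi_verts_def)

lemma rank_Phi_gen:
  assumes "(x, y) \<in> Phi_gen n"
  shows "rank y = rank x + 1"
proof -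
  have xy: "x \<in> carrier_vec n" "y \<in> carrier_vec n" "alternating (list_of_vec (y - x))"
    using assms by (auto simp: Phi_gen_def Phi_verts_def)
  then have "(\<Sum>j<n. (y - x) $ j) = 1"
    using alternating_vec_iff[of "y - x" n] by simp
  then have "(\<Sum>j<n. y $ j - x $ j) = 1" using xy by simp
  then show ?thesis using xy by (simp add: rank_def sum_subtractf)
qed

text \<open>Every generating step raises the rank. This excludes cycles, bounds what can lie between
  two vertices, and shows that vertices of extreme rank are minimal or maximal.\<close>

lemma rank_Phi_gen_rtrancl:
  assumes "(x, y) \<in> (Phi_gen n)\<^sup>*"
  shows "x = y \<or> rank x < rank y"
  using assms
proof (induction rule: rtrancl_induct)
  case (step y z)
  then show ?case using rank_Phi_gen[of y z n] by auto
qed simp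

lemma Phi_gen_verts:
  assumes "(x, y) \<in> Phi_gen n"
  shows "x \<in> Phi_verts n" "y \<in> Phi_verts n"
  using assms by (auto simp: Phi_gen_def)

lemma partial_order_Phi: "partial_order_on (Phi_verts n) (Phi_order n)"
  unfolding partial_order_on_def preorder_on_def
proof (intro conjI)
  show "refl_on (Phi_verts n) (Phi_order n)"
    by (auto simp: refl_on_def Phi_order_def)
  show "trans (Phi_order n)"
    by (auto simp: trans_def Phi_order_def)
  show "antisym (Phi_order n)"
  proof (rule antisymI)
    fix x y assume "(x, y) \<in> Phi_order n" "(y, x) \<in> Phi_order n"
    then show "x = y"
      using rank_Phi_gen_rtrancl[of x y n] rank_Phi_gen_rtrancl[of y x n]
      by (auto simp: Phi_order_def)
  qed
qed (auto simp: Phi_order_def)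

text \<open>A cover admits no intermediate vertex, so the first step of a generating path from
  \<open>x\<close> must already end at \<open>y\<close>. Conversely, a generating step raises the
  integer rank by 1, leaving no value for a vertex strictly between.\<close>

lemma covers_in_Phi_iff_gen:
  "covers_in (Phi_verts n) (Phi_order n) y x \<longleftrightarrow> (x, y) \<in> Phi_gen n"
proof
  assume "covers_in (Phi_verts n) (Phi_order n) y x"
  then have path: "(x, y) \<in> (Phi_gen n)\<^sup>*" and "x \<noteq> y"
    and y: "y \<in> Phi_verts n"
    and none: "\<And>z. z \<in> Phi_verts n \<Longrightarrow> (x, z) \<in> Phi_order n \<Longrightarrow> x \<noteq> z \<Longrightarrow>
      (z, y) \<in> Phi_order n \<Longrightarrow> z = y"
    unfolding covers_in_def Phi_order_def by auto
  from path \<open>x \<noteq> y\<close> obtain z where z: "(x, z) \<in> Phi_gen n" "(z, y) \<in> (Phi_gen n)\<^sup>*"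
    by (meson converse_rtranclE)
  have "x \<noteq> z" using rank_Phi_gen[OF z(1)] by auto
  then have "z = y"
    using none[of z] z y Phi_gen_verts[OF z(1)]
    by (auto simp: Phi_order_def)
  with z show "(x, y) \<in> Phi_gen n" by simp
next
  assume gen: "(x, y) \<in> Phi_gen n"
  show "covers_in (Phi_verts n) (Phi_order n) y x"
    unfolding covers_in_def
  proof (intro conjI notI)
    show "x \<in> Phi_verts n" "y \<in> Phi_verts n" using Phi_gen_verts[OF gen] .
    show "(x, y) \<in> Phi_order n" using gen Phi_gen_verts[OF gen] by (auto simp: Phi_order_def)
    show "x = y \<Longrightarrow> False" using rank_Phi_gen[OF gen] by simp
    assume "\<exists>z\<in>Phi_verts n. (x, z) \<in> Phi_order n \<and> x \<noteq> z \<and> (z, y) \<in> Phi_order n \<and> z \<noteq> y"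
    then obtain z where "rank x < rank z" "rank z < rank y"
      using rank_Phi_gen_rtrancl by (fastforce simp: Phi_order_def)
    then show False using rank_Phi_gen[OF gen] by linarith
  qed
qed

section \<open>Minimal and maximal elements\<close>

lemma alternating_unit_vec:
  assumes "i < n"
  shows "alternating (list_of_vec (unit_vec n i))"
proof -
  have "(\<Sum>j<m. unit_vec n i $ j) = (if i < m then 1 else 0 :: int)" if "m \<le> n" for m
  proof -
    have "(\<Sum>j<m. unit_vec n i $ j) = (\<Sum>j<m. if j = i then 1 else 0 :: int)"
      using that assms by (intro sum.cong) auto
    then show ?thesis by simp
  qed
  then show ?thesis
    using assms by (subst alternating_vec_iff[of _ n]) auto
qed

text \<open>Flipping one coordinate gives each vertex other than the zero vector a lower neighbour,
  and each vertex other than the all-one vector an upper one.\<close>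

lemma Phi_gen_flip:
  assumes "x \<in> Phi_verts n" "y \<in> Phi_verts n" "i < n" "y = x + unit_vec n i"
  shows "(x, y) \<in> Phi_gen n"
proof -
  have "y - x = unit_vec n i"
    using assms by (auto simp: Phi_verts_def)
  then show ?thesis
    using assms alternating_unit_vec[of i n] by (simp add: Phi_gen_def)
qed

text \<open>In a nonzero vertex some 1 can be flipped to 0, which yields a smaller vertex. Nothing
  lies strictly below the zero vector, because ranks are nonnegative.\<close>

lemma minimal_in_Phi_iff:
  "minimal_in (Phi_verts n) (Phi_order n) x \<longleftrightarrow> x = 0\<^sub>v n"
proof
  assume min: "minimal_in (Phi_verts n) (Phi_order n) x"
  then have x: "x \<in> Phi_verts n" by (simp add: minimal_in_def)
  show "x = 0\<^sub>v n"
  proof (rule ccontr)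
    assume "x \<noteq> 0\<^sub>v n"
    then obtain i where i: "i < n" "x $ i = 1"
      using x by (auto simp: Phi_verts_def vec_eq_iff)
    define y where "y = x - unit_vec n i"
    have y: "y \<in> Phi_verts n" using x i by (auto simp: y_def Phi_verts_def)
    have "x = y + unit_vec n i" using x by (auto simp: y_def Phi_verts_def)
    then have gen: "(y, x) \<in> Phi_gen n" using Phi_gen_flip x y i by blast
    then have "y = x" using min x y by (auto simp: minimal_in_def Phi_order_def)
    then show False using rank_Phi_gen[OF gen] by simp
  qed
next
  assume x: "x = 0\<^sub>v n"
  have rank0: "rank x = 0" by (simp add: x rank_def)
  have "0 \<le> rank y" if "y \<in> Phi_verts n" for y
    unfolding rank_def using that by (intro sum_nonneg) (force simp: Phi_verts_def)
  then show "minimal_in (Phi_verts n) (Phi_order n) x"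
    using rank_Phi_gen_rtrancl rank0 x
    by (fastforce simp: minimal_in_def Phi_order_def Phi_verts_def)
qed

text \<open>Dual argument: flip a 0 to 1, and bound all ranks by \<open>n\<close>.\<close>

lemma maximal_in_Phi_iff:
  "maximal_in (Phi_verts n) (Phi_order n) x \<longleftrightarrow> x = vec n (\<lambda>_. 1)"
proof
  assume max: "maximal_in (Phi_verts n) (Phi_order n) x"
  then have x: "x \<in> Phi_verts n" by (simp add: maximal_in_def)
  show "x = vec n (\<lambda>_. 1)"
  proof (rule ccontr)
    assume "x \<noteq> vec n (\<lambda>_. 1)"
    then obtain i where i: "i < n" "x $ i = 0"
      using x by (auto simp: Phi_verts_def vec_eq_iff)
    define y where "y = x + unit_vec n i"
    have y: "y \<in> Phi_verts n" using x i by (auto simp: y_def Phi_verts_def)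
    have gen: "(x, y) \<in> Phi_gen n" using Phi_gen_flip x y i y_def by blast
    then have "y = x" using max x y by (auto simp: maximal_in_def Phi_order_def)
    then show False using rank_Phi_gen[OF gen] by simp
  qed
next
  assume x: "x = vec n (\<lambda>_. 1)"
  have rankn: "rank x = int n" by (simp add: x rank_def)
  have "rank y \<le> int n" if "y \<in> Phi_verts n" for y
  proof -
    have "rank y \<le> (\<Sum>j<dim_vec y. 1)"
      unfolding rank_def using that by (intro sum_mono) (force simp: Phi_verts_def)
    then show ?thesis using Phi_verts_carrier[OF that] by simp
  qed
  then show "maximal_in (Phi_verts n) (Phi_order n) x"
    using rank_Phi_gen_rtrancl rankn x
    by (fastforce simp: maximal_in_def Phi_order_def Phi_verts_def)
qed

section \<open>Maximal chains and alternating sign matrices\<close>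

text \<open>Along the chain the rank starts at 0 and grows by 1 per step, so it equals the index;
  the top has rank \<open>n\<close>, which fixes the length.\<close>

lemma Phi_maximal_chains_iff:
  "xs \<in> Phi_maximal_chains n \<longleftrightarrow> length xs = n + 1 \<and> xs ! 0 = 0\<^sub>v n \<and> xs ! n = vec n (\<lambda>_. 1) \<and>
    (\<forall>i<n. (xs ! i, xs ! Suc i) \<in> Phi_gen n)"
proof
  assume "xs \<in> Phi_maximal_chains n"
  then have xs: "xs \<noteq> []" "hd xs = 0\<^sub>v n" "last xs = vec n (\<lambda>_. 1)"
    and gen: "\<And>i. 1 \<le> i \<Longrightarrow> i < length xs \<Longrightarrow> (xs ! (i - 1), xs ! i) \<in> Phi_gen n"
    by (auto simp: maximal_chains_def minimal_in_Phi_iff maximal_in_Phi_iff covers_in_Phi_iff_gen)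
  have rank: "rank (xs ! i) = int i" if "i < length xs" for i
    using that
  proof (induction i)
    case 0
    then show ?case using xs by (simp add: hd_conv_nth[symmetric] rank_def)
  next
    case (Suc i)
    then show ?case using rank_Phi_gen[OF gen[of "Suc i"]] by simp
  qed
  have "rank (last xs) = int n" by (simp add: xs rank_def)
  then have "length xs = n + 1"
    using rank[of "length xs - 1"] xs(1) by (simp add: last_conv_nth)
  then show "length xs = n + 1 \<and> xs ! 0 = 0\<^sub>v n \<and> xs ! n = vec n (\<lambda>_. 1) \<and>
    (\<forall>i<n. (xs ! i, xs ! Suc i) \<in> Phi_gen n)"
    using xs gen[of "Suc _"] by (auto simp: hd_conv_nth last_conv_nth)
next
  assume R: "length xs = n + 1 \<and> xs ! 0 = 0\<^sub>v n \<and> xs ! n = vec n (\<lambda>_. 1) \<and>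
    (\<forall>i<n. (xs ! i, xs ! Suc i) \<in> Phi_gen n)"
  then have "xs \<noteq> []" by auto
  moreover have "(xs ! (i - 1), xs ! i) \<in> Phi_gen n" if "1 \<le> i" "i < length xs" for i
    using R that by (cases i) auto
  ultimately show "xs \<in> Phi_maximal_chains n"
    using R by (auto simp: maximal_chains_def minimal_in_Phi_iff maximal_in_Phi_iff
      covers_in_Phi_iff_gen hd_conv_nth last_conv_nth)
qed

lemma Phi_chain_nth_verts:
  assumes "xs \<in> Phi_maximal_chains n" "i \<le> n"
  shows "xs ! i \<in> Phi_verts n"
\<comment> \<open>No step of the chain leaves index \<open>n\<close>, so the top vertex is handled
  separately.\<close>
proof (cases "i = n")
  case True
  then have "xs ! i = vec n (\<lambda>_. 1)" using assms by (simp add: Phi_maximal_chains_iff)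
  then show ?thesis by (simp add: Phi_verts_def)
next
  case False
  then have "(xs ! i, xs ! Suc i) \<in> Phi_gen n" using assms by (simp add: Phi_maximal_chains_iff)
  then show ?thesis by (rule Phi_gen_verts)
qed

text \<open>Only the column condition is unfolded: a prefix sum of column \<open>j\<close> is
  coordinate \<open>j\<close> of a sum of initial rows, hence of a chain element. The rows stay
  alternating vectors, as in \<open>Phi_gen\<close>.\<close>

lemma asms_iff:
  "A \<in> asms n \<longleftrightarrow> A \<in> carrier_mat n n \<and> (\<forall>i<n. alternating (list_of_vec (row A i))) \<and>
    (\<forall>j<n. (\<forall>m\<le>n. (\<Sum>k<m. A $$ (k, j)) \<in> {0, 1}) \<and> (\<Sum>k<n. A $$ (k, j)) = 1)"
proof (cases "A \<in> carrier_mat n n")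
  case True
  have "alternating (list_of_vec (col A j)) \<longleftrightarrow>
      (\<forall>m\<le>n. (\<Sum>k<m. A $$ (k, j)) \<in> {0, 1}) \<and> (\<Sum>k<n. A $$ (k, j)) = 1" if "j < n" for j
  proof -
    have "(\<Sum>k<m. col A j $ k) = (\<Sum>k<m. A $$ (k, j))" if "m \<le> n" for m
      using True \<open>j < n\<close> that by (intro sum.cong) auto
    moreover have "col A j \<in> carrier_vec n" using True by (simp add: col_def)
    ultimately show ?thesis by (simp add: alternating_vec_iff)
  qed
  then show ?thesis using True by (simp add: asms_def)
qed (simp add: asms_def)

section \<open>From chains to matrices\<close>

lemma chain_to_asm_index:
  assumes "length xs = n + 1" "i < n" "j < n" "xs ! i \<in> carrier_vec n" "xs ! Suc i \<in> carrier_vec n"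
  shows "chain_to_asm n xs $$ (i, j) = xs ! Suc i $ j - xs ! i $ j"
  \<comment> \<open>Entry \<open>i\<close> of \<open>[1..<n + 1]\<close> is \<open>Suc i\<close>, so
    row \<open>i\<close>, counted from 0, is the step leaving \<open>xs ! i\<close>.\<close>
  using assms by (simp add: chain_to_asm_def mat_of_rows_def del: upt_Suc)

lemma chain_to_asm_carrier:
  "length xs = n + 1 \<Longrightarrow> chain_to_asm n xs \<in> carrier_mat n n"
  by (simp add: chain_to_asm_def mat_of_rows_def del: upt_Suc)

text \<open>The differences telescope, and the chain starts at the zero vector.\<close>

lemma chain_to_asm_partial_sum:
  assumes xs: "xs \<in> Phi_maximal_chains n" and "m \<le> n" "j < n"
  shows "(\<Sum>k<m. chain_to_asm n xs $$ (k, j)) = xs ! m $ j"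
proof -
  have len: "length xs = n + 1" and "xs ! 0 = 0\<^sub>v n"
    using xs by (auto simp: Phi_maximal_chains_iff)
  have "(\<Sum>k<m. chain_to_asm n xs $$ (k, j)) = (\<Sum>k<m. xs ! Suc k $ j - xs ! k $ j)"
    using assms Phi_verts_carrier[OF Phi_chain_nth_verts[OF xs]]
    by (intro sum.cong) (auto intro!: chain_to_asm_index[OF len])
  also have "\<dots> = xs ! m $ j - xs ! 0 $ j" by (rule sum_lessThan_telescope)
  finally show ?thesis using \<open>xs ! 0 = 0\<^sub>v n\<close> \<open>j < n\<close> by simp
qed

text \<open>Rows are steps of the chain. Column prefix sums are coordinates of chain elements, hence
  0 or 1, and the column totals are read off the all-one vector.\<close>

lemma chain_to_asm_in_asms:
  assumes xs: "xs \<in> Phi_maximal_chains n"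
  shows "chain_to_asm n xs \<in> asms n"
  unfolding asms_iff
proof (intro conjI allI impI)
  have len: "length xs = n + 1" and top: "xs ! n = vec n (\<lambda>_. 1)"
    using xs by (auto simp: Phi_maximal_chains_iff)
  note verts = Phi_chain_nth_verts[OF xs]
  show carrier: "chain_to_asm n xs \<in> carrier_mat n n" by (rule chain_to_asm_carrier[OF len])
  show "alternating (list_of_vec (row (chain_to_asm n xs) i))" if "i < n" for i
  proof -
    have "row (chain_to_asm n xs) i = xs ! Suc i - xs ! i"
      using that carrier Phi_verts_carrier[OF verts, of i] Phi_verts_carrier[OF verts, of "Suc i"]
      by (intro eq_vecI) (auto simp: chain_to_asm_index[OF len])
    then show ?thesis using xs that by (auto simp: Phi_maximal_chains_iff Phi_gen_def)
  qed
  fix j assume j: "j < n"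
  show "(\<Sum>k<n. chain_to_asm n xs $$ (k, j)) = 1"
    using j by (simp add: chain_to_asm_partial_sum[OF xs] top)
  show "(\<Sum>k<m. chain_to_asm n xs $$ (k, j)) \<in> {0, 1}" if "m \<le> n" for m
    using j that verts[of m] chain_to_asm_partial_sum[OF xs that j] by (simp add: Phi_verts_def)
qed

section \<open>From matrices to chains\<close>

lemma asm_to_chain_nth:
  assumes "A \<in> carrier_mat n n" "i \<le> n"
  shows "asm_to_chain n A ! i = vec n (\<lambda>j. \<Sum>k<i. A $$ (k, j))"
proof -
  have "asm_to_chain n A ! i = vec n (\<lambda>j. \<Sum>k<i. row A k $ j)"
    using assms by (simp add: asm_to_chain_def del: upt_Suc)
  \<comment> \<open>The bound \<open>i \<le> n\<close> keeps every summed row index inside the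
    matrix.\<close>
  also have "\<dots> = vec n (\<lambda>j. \<Sum>k<i. A $$ (k, j))"
    using assms by (intro eq_vecI) (auto intro!: sum.cong)
  finally show ?thesis .
qed

text \<open>The column conditions make all row sums vertices and the last one the all-one vector;
  consecutive sums differ by a row, which is alternating.\<close>

lemma asm_to_chain_in_chains:
  assumes A: "A \<in> asms n"
  shows "asm_to_chain n A \<in> Phi_maximal_chains n"
  unfolding Phi_maximal_chains_iff
proof (intro conjI allI impI)
  have carrier: "A \<in> carrier_mat n n" using A by (simp add: asms_iff)
  note nth = asm_to_chain_nth[OF carrier]
  have verts: "asm_to_chain n A ! i \<in> Phi_verts n" if "i \<le> n" for i
    using A that by (simp add: nth Phi_verts_def asms_iff)
  show "length (asm_to_chain n A) = n + 1" by (simp add: asm_to_chain_def)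
  show "asm_to_chain n A ! 0 = 0\<^sub>v n" by (auto simp: nth)
  show "asm_to_chain n A ! n = vec n (\<lambda>_. 1)"
    using A by (auto simp: nth asms_iff)
  fix i assume i: "i < n"
  have "asm_to_chain n A ! Suc i - asm_to_chain n A ! i = row A i"
    using i carrier by (intro eq_vecI) (auto simp: nth)
  then show "(asm_to_chain n A ! i, asm_to_chain n A ! Suc i) \<in> Phi_gen n"
    using verts[of i] verts[of "Suc i"] i A by (simp add: Phi_gen_def asms_iff)
qed

section \<open>The two maps are mutually inverse\<close>

lemma asm_to_chain_to_asm:
  assumes "A \<in> asms n"
  shows "chain_to_asm n (asm_to_chain n A) = A"
proof -
  have carrier: "A \<in> carrier_mat n n" using assms by (simp add: asms_iff)
  have len: "length (asm_to_chain n A) = n + 1" by (simp add: asm_to_chain_def)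
  show ?thesis
    \<comment> \<open>Subtracting consecutive row sums leaves the single row added last.\<close>
    using carrier chain_to_asm_carrier[OF len]
    by (intro eq_matI) (auto simp: chain_to_asm_index[OF len] asm_to_chain_nth)
qed

lemma chain_to_asm_to_chain:
  assumes xs: "xs \<in> Phi_maximal_chains n"
  shows "asm_to_chain n (chain_to_asm n xs) = xs"
proof (rule nth_equalityI)
  have len: "length xs = n + 1" using xs by (simp add: Phi_maximal_chains_iff)
  then show "length (asm_to_chain n (chain_to_asm n xs)) = length xs"
    by (simp add: asm_to_chain_def)
  fix i assume "i < length (asm_to_chain n (chain_to_asm n xs))"
  then have i: "i \<le> n" by (simp add: asm_to_chain_def)
  then show "asm_to_chain n (chain_to_asm n xs) ! i = xs ! i"
    using Phi_verts_carrier[OF Phi_chain_nth_verts[OF xs i]]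
    by (intro eq_vecI)
      (auto simp: asm_to_chain_nth chain_to_asm_carrier[OF len] chain_to_asm_partial_sum[OF xs])
qed

theorem theorem3p2:
  fixes n :: nat
  assumes "n \<ge> 1"
  shows "partial_order_on (Phi_verts n) (Phi_order n) \<and>
    (\<forall>x\<in>Phi_verts n. \<forall>y\<in>Phi_verts n.
       covers_in (Phi_verts n) (Phi_order n) y x \<longleftrightarrow> alternating (list_of_vec (y - x))) \<and>
    (\<forall>xs\<in>Phi_maximal_chains n. length xs = n + 1) \<and>
    bij_betw (chain_to_asm n) (Phi_maximal_chains n) (asms n) \<and>
    bij_betw (asm_to_chain n) (asms n) (Phi_maximal_chains n) \<and>
    (\<forall>xs\<in>Phi_maximal_chains n. asm_to_chain n (chain_to_asm n xs) = xs) \<and>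
    (\<forall>A\<in>asms n. chain_to_asm n (asm_to_chain n A) = A)"
proof (intro conjI ballI)
  show "partial_order_on (Phi_verts n) (Phi_order n)" by (rule partial_order_Phi)
  show "covers_in (Phi_verts n) (Phi_order n) y x \<longleftrightarrow> alternating (list_of_vec (y - x))"
    if "x \<in> Phi_verts n" "y \<in> Phi_verts n" for x y
    using that by (simp add: covers_in_Phi_iff_gen Phi_gen_def)
  show "length xs = n + 1" if "xs \<in> Phi_maximal_chains n" for xs
    using that by (simp add: Phi_maximal_chains_iff)
  \<comment> \<open>Each map serves as the inverse witness of the other, so the same four facts give
    both bijections.\<close>
  show "bij_betw (chain_to_asm n) (Phi_maximal_chains n) (asms n)"
    by (rule bij_betw_byWitness[where f' = "asm_to_chain n"])
      (auto simp: asm_to_chain_to_asm chain_to_asm_to_chain chain_to_asm_in_asms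
        asm_to_chain_in_chains)
  show "bij_betw (asm_to_chain n) (asms n) (Phi_maximal_chains n)"
    by (rule bij_betw_byWitness[where f' = "chain_to_asm n"])
      (auto simp: asm_to_chain_to_asm chain_to_asm_to_chain chain_to_asm_in_asms
        asm_to_chain_in_chains)
qed (simp_all add: asm_to_chain_to_asm chain_to_asm_to_chain)

end
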